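(* Let $f:\mathbb{R}^n\to\mathbb{R}\cup\{+\infty\}$ be proper, lower semicontinuous and convex, and let $A\in\mathbb{R}^{m\times n}$. If $f$ is coercive on $\ker A$, then the following hold. (i) For every $x_0\in\operatorname{dom}f$ there is $\alpha>0$ such that $B_\alpha(0)\subseteq\operatorname{ran}A^\top+(B_\alpha(0)\cap\ker A)\subseteq\operatorname{dom}\big(f(x_0+\cdot)|_{\ker A}\big)^*$. (ii) $0\in\operatorname{int}\operatorname{dom}\big(f(x_0+\cdot)|_{\ker A}\big)^*$ for every $x_0\in\operatorname{dom}f$. (iii) If $0\in\operatorname{dom}f$, then $B_\alpha(0)\subseteq\operatorname{dom}(f|_{\ker A})^*$ for some $\alpha>0$, and $0\in\operatorname{int}\operatorname{dom}(f|_{\ker A})^*$. (iv) $(f_\infty)|_{\ker A}=\sigma_{\mathcal P_{\ker A}(\operatorname{dom}f^* )}|_{\ker A}=\sigma_{\operatorname{dom}f^*}|_{\ker A}$. (v) $0\in\operatorname{ri}\,\mathcal P_{\ker A}(\operatorname{dom}f^* )$.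
   Context: Restricted coercivity: $f$ is coercive on a proper linear subspace $D\subset\mathbb{R}^n$ if $\lim_{\|\mathcal P_Dx\|\to+\infty}f(x)=+\infty$, where $\mathcal P_D$ is the orthogonal projection onto $D$ and $x$ ranges over $\mathbb{R}^n$. For a function $h$ and a subspace $D$, $h|_D$ denotes $h+\iota_D$, i.e. the function equal to $h$ on $D$ and $+\infty$ elsewhere; thus $f(x_0+\cdot)|_{\ker A}$ is $d\mapsto f(x_0+d)+\iota_{\ker A}(d)$. $B_\alpha(0)$ is the ball of radius $\alpha$ centered at $0$ in $\mathbb{R}^n$. $h^*$ is the convex conjugate, $\sigma_C(d)=\sup_{u\in C}\langle u,d\rangle$ the support function, and $f_\infty(d)=\lim_{t\to+\infty}\frac{f(x+td)-f(x)}{t}$ (any $x\in\operatorname{dom}f$) the recession function. $\operatorname{ri}$ is the relative interior. *)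

theory Defs
  imports "HOL-Analysis.Analysis"
begin

text \<open>
  Functions with values in the extended reals; \<open>R \<union> {+\<infinity>}\<close> is rendered by excluding the
  value \<open>-\<infinity>\<close> in \<open>proper_fun\<close>.
\<close>

definition eff_dom :: "('a \<Rightarrow> ereal) \<Rightarrow> 'a set" where
  "eff_dom f = {x. f x < \<infinity>}"

definition proper_fun :: "('a \<Rightarrow> ereal) \<Rightarrow> bool" where
  "proper_fun f \<longleftrightarrow> (\<forall>x. f x \<noteq> -\<infinity>) \<and> eff_dom f \<noteq> {}"

definition lsc_fun :: "('a::topological_space \<Rightarrow> ereal) \<Rightarrow> bool" where
  "lsc_fun f \<longleftrightarrow> (\<forall>x. f x \<le> Liminf (at x) f)"

text \<open>
  Jensen's inequality is unambiguous only for functions that avoid \<open>-\<infinity>\<close>, so this is meant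
  to be used together with \<open>proper_fun\<close>. At the endpoints it is harmless since \<open>0 * \<infinity> = 0\<close>.
\<close>

definition convex_fun :: "('a::real_vector \<Rightarrow> ereal) \<Rightarrow> bool" where
  "convex_fun f \<longleftrightarrow>
     (\<forall>x y. \<forall>t\<in>{0..1::real}.
        f ((1 - t) *\<^sub>R x + t *\<^sub>R y) \<le> ereal (1 - t) * f x + ereal t * f y)"

definition orth_proj :: "'a::euclidean_space set \<Rightarrow> 'a \<Rightarrow> 'a" where
  "orth_proj D x = (THE y. y \<in> D \<and> (\<forall>z\<in>D. orthogonal (x - y) z))"

text \<open>
  \<open>x\<close> ranges over the whole space, not just over \<open>D\<close>. The subspace is not required to differ
  from the whole space: for \<open>D = UNIV\<close> this is ordinary coercivity.
\<close>

definition coercive_wrt :: "('a::euclidean_space \<Rightarrow> ereal) \<Rightarrow> 'a set \<Rightarrow> bool" where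
  "coercive_wrt f D \<longleftrightarrow> (f \<longlongrightarrow> \<infinity>) (filtercomap (\<lambda>x. norm (orth_proj D x)) at_top)"

text \<open>The sum of \<open>h\<close> and the indicator function of \<open>D\<close>.\<close>

definition restr :: "('a \<Rightarrow> ereal) \<Rightarrow> 'a set \<Rightarrow> 'a \<Rightarrow> ereal" where
  "restr h D x = (if x \<in> D then h x else \<infinity>)"

definition conjugate :: "('a::euclidean_space \<Rightarrow> ereal) \<Rightarrow> 'a \<Rightarrow> ereal" where
  "conjugate h u = (SUP x. ereal (u \<bullet> x) - h x)"

definition support_fun :: "'a::euclidean_space set \<Rightarrow> 'a \<Rightarrow> ereal" where
  "support_fun C d = (SUP u\<in>C. ereal (u \<bullet> d))"

text \<open>
  The common limit, over all base points \<open>x\<close> in the domain, of the difference quotients; for a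
  proper lower semicontinuous convex function it exists and does not depend on \<open>x\<close>.
\<close>

definition recession :: "('a::euclidean_space \<Rightarrow> ereal) \<Rightarrow> 'a \<Rightarrow> ereal" where
  "recession f d =
     (THE l. \<forall>x\<in>eff_dom f. ((\<lambda>t::real. (f (x + t *\<^sub>R d) - f x) / ereal t) \<longlongrightarrow> l) at_top)"

definition ker_mat :: "real^'n^'m \<Rightarrow> (real^'n) set" where
  "ker_mat A = {x. A *v x = 0}"

definition ran_mat :: "real^'n^'m \<Rightarrow> (real^'m) set" where
  "ran_mat A = range (\<lambda>x. A *v x)"

end

theory Submission
  imports Defs
begin

text \<open>
  Write \<open>D\<close> for the kernel of \<open>A\<close>. Two facts carry the whole theorem.

  The first is that coercivity on \<open>D\<close> makes \<open>f\<close> grow at least linearly along every slice \<open>x0 + D\<close>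
  through its domain (\<open>coercive_linear_growth\<close>): once \<open>f\<close> exceeds its value at \<open>x0\<close> by \<open>1\<close> on a
  sphere of radius \<open>R\<close> in the slice, convexity along rays from \<open>x0\<close> forces growth of slope
  \<open>1 / R\<close> outside.
  A linear functional whose component in \<open>D\<close> has norm at most this slope therefore stays below
  the slice up to a constant, that is, it lies in the domain of the conjugate of the slice. The
  component orthogonal to \<open>D\<close> is invisible on \<open>D\<close>, and the orthogonal complement of \<open>D\<close> is the
  range of the transpose of \<open>A\<close>. This gives the statements on the slices.

  The second is that a proper lower semicontinuous convex function is the supremum of its affine
  minorants (\<open>affine_minorant_above\<close>), obtained by separating points from the epigraph. The
  slopes of these minorants are exactly the points of the domain of the conjugate, so with
  \<open>s = support_fun (eff_dom (conjugate f)) d\<close> one has \<open>f (x + t d) \<le> f x + t s\<close>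
  (\<open>upper_bound_by_slopes\<close>), while each minorant pushes the difference quotients up to its own
  slope in the limit. Hence the recession function is the support function of the domain of the
  conjugate, and for directions in \<open>D\<close> that domain may be projected onto \<open>D\<close>.

  Combining both, this support function is positive at every nonzero direction of \<open>D\<close>, since
  otherwise \<open>f\<close> would be bounded above along a ray whose direction lies in \<open>D\<close>. If \<open>0\<close> were not in the relative interior of
  the projected domain, a separating hyperplane would produce a direction of \<open>D\<close> violating this.
\<close>

section \<open>Orthogonal projection onto a subspace\<close>

lemma orth_proj_unique:
  assumes D: "subspace D" and "y \<in> D" "\<forall>z\<in>D. orthogonal (x - y) z"
  shows "orth_proj D x = y"
  unfolding orth_proj_def
proof (rule the_equality)
  fix y' assume y': "y' \<in> D \<and> (\<forall>z\<in>D. orthogonal (x - y') z)"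
  have "y' - y \<in> D" using D y' assms(2) by (simp add: subspace_diff)
  then have "(x - y) \<bullet> (y' - y) = 0" "(x - y') \<bullet> (y' - y) = 0"
    using assms(3) y' by (auto simp: orthogonal_def)
  then have "(y' - y) \<bullet> (y' - y) = 0" by (simp add: inner_diff_left)
  then show "y' = y" by simp
qed (use assms in auto)

lemma orth_proj_props:
  assumes D: "subspace D"
  shows "orth_proj D x \<in> D" "z \<in> D \<Longrightarrow> (x - orth_proj D x) \<bullet> z = 0"
proof -
  obtain y w where y: "y \<in> span D" "\<And>v. v \<in> span D \<Longrightarrow> orthogonal w v" "x = y + w"
    by (rule orthogonal_subspace_decomp_exists[of D x]) blast
  have sp: "span D = D" using D by (rule span_eq_iff[THEN iffD2])
  have "orth_proj D x = y"
    by (rule orth_proj_unique[OF D]) (use y sp in auto)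
  then show "orth_proj D x \<in> D" "z \<in> D \<Longrightarrow> (x - orth_proj D x) \<bullet> z = 0"
    using y sp by (auto simp: orthogonal_def)
qed

lemma orth_proj_inner:
  assumes "subspace D" "z \<in> D"
  shows "orth_proj D x \<bullet> z = x \<bullet> z"
  using orth_proj_props(2)[OF assms, of x] by (simp add: inner_diff_left)

lemma orth_proj_id:
  assumes "subspace D" "x \<in> D"
  shows "orth_proj D x = x"
  by (rule orth_proj_unique) (use assms in \<open>auto simp: orthogonal_def\<close>)

lemma linear_orth_proj:
  assumes D: "subspace D"
  shows "linear (orth_proj D)"
proof (rule linearI)
  fix x y :: 'a and c :: real
  show "orth_proj D (x + y) = orth_proj D x + orth_proj D y"
    by (rule orth_proj_unique[OF D])
      (use D in \<open>auto simp: orthogonal_def subspace_add orth_proj_props orth_proj_inner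
         inner_diff_left inner_add_left\<close>)
  show "orth_proj D (c *\<^sub>R x) = c *\<^sub>R orth_proj D x"
    by (rule orth_proj_unique[OF D])
      (use D in \<open>auto simp: orthogonal_def subspace_scale orth_proj_props orth_proj_inner
         inner_diff_left\<close>)
qed

lemma norm_orth_proj_le:
  assumes D: "subspace D"
  shows "norm (orth_proj D x) \<le> norm x"
proof (cases "orth_proj D x = 0")
  case False
  have "norm (orth_proj D x) * norm (orth_proj D x) = x \<bullet> orth_proj D x"
    using orth_proj_inner[OF D orth_proj_props(1)[OF D], of x x]
    by (simp add: power2_norm_eq_inner flip: power2_eq_square)
  also have "\<dots> \<le> norm x * norm (orth_proj D x)" by (rule norm_cauchy_schwarz)
  finally show ?thesis using False by simp
qed simp

section \<open>Affine minorants of convex functions\<close>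

text \<open>
  Membership in the domain of the conjugate means being the slope of an affine minorant; in this
  form the infinite values of \<open>h\<close> need no separate treatment.
\<close>

lemma eff_dom_conjugate_iff:
  "u \<in> eff_dom (conjugate h) \<longleftrightarrow> (\<exists>b. \<forall>y. ereal (u \<bullet> y - b) \<le> h y)"
proof -
  have iff: "ereal (u \<bullet> y) - h y \<le> ereal b \<longleftrightarrow> ereal (u \<bullet> y - b) \<le> h y" for y b
    by (cases "h y") auto
  have "conjugate h u < \<infinity> \<longleftrightarrow> (\<exists>b. conjugate h u \<le> ereal b)"
    by (cases "conjugate h u") auto
  then show ?thesis
    by (simp add: eff_dom_def conjugate_def SUP_le_iff iff)
qed

lemma convex_eff_dom_conjugate:
  "convex (eff_dom (conjugate h))"
proof (rule convexI)
  fix u v and s t :: real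
  assume "u \<in> eff_dom (conjugate h)" "v \<in> eff_dom (conjugate h)" and st: "0 \<le> s" "0 \<le> t" "s + t = 1"
  then obtain a b where a: "\<And>y. ereal (u \<bullet> y - a) \<le> h y" and b: "\<And>y. ereal (v \<bullet> y - b) \<le> h y"
    by (auto simp: eff_dom_conjugate_iff)
  have "ereal ((s *\<^sub>R u + t *\<^sub>R v) \<bullet> y - (s * a + t * b)) \<le> h y" for y
  proof -
    have "s * (u \<bullet> y - a) + t * (v \<bullet> y - b) \<le> max (u \<bullet> y - a) (v \<bullet> y - b)"
      using st by (intro convex_bound_le) auto
    then have "ereal ((s *\<^sub>R u + t *\<^sub>R v) \<bullet> y - (s * a + t * b))
        \<le> max (ereal (u \<bullet> y - a)) (ereal (v \<bullet> y - b))"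
      by (simp add: inner_add_left algebra_simps ereal_max[symmetric] del: ereal_max)
    also have "\<dots> \<le> h y" using a b by simp
    finally show ?thesis .
  qed
  then show "s *\<^sub>R u + t *\<^sub>R v \<in> eff_dom (conjugate h)"
    unfolding eff_dom_conjugate_iff by blast
qed

definition epigraph :: "('a \<Rightarrow> ereal) \<Rightarrow> ('a \<times> real) set" where
  "epigraph f = {(y, r). f y \<le> ereal r}"

lemma convex_epigraph:
  assumes "convex_fun f"
  shows "convex (epigraph f)"
proof (rule convexI)
  fix p q and s t :: real
  assume pq: "p \<in> epigraph f" "q \<in> epigraph f" and st: "0 \<le> s" "0 \<le> t" "s + t = 1"
  obtain x a where p: "p = (x, a)" by fastforce
  obtain y b where q: "q = (y, b)" by fastforce
  have s: "s = 1 - t" using st by simp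
  have "f (s *\<^sub>R x + t *\<^sub>R y) \<le> ereal s * f x + ereal t * f y"
    using assms st unfolding convex_fun_def s by auto
  also have "\<dots> \<le> ereal s * ereal a + ereal t * ereal b"
    using pq st by (intro add_mono ereal_mult_left_mono) (auto simp: epigraph_def p q)
  finally show "s *\<^sub>R p + t *\<^sub>R q \<in> epigraph f" by (simp add: p q epigraph_def)
qed

text \<open>
  Lower semicontinuity makes the strict superlevel sets open, and the complement of the epigraph
  is the union of their products \<open>{y. m < f y} \<times> {..<m}\<close>.
\<close>

lemma closed_epigraph:
  assumes "lsc_fun f"
  shows "closed (epigraph f)"
proof -
  have "open {y. ereal m < f y}" for m
  proof (subst open_subopen, safe)
    fix x assume m: "ereal m < f x"
    have "f x \<le> Liminf (at x) f" using assms by (simp add: lsc_fun_def)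
    then have "eventually (\<lambda>y. ereal m < f y) (at x)" using m by (simp add: le_Liminf_iff)
    then obtain S where S: "open S" "x \<in> S" "\<forall>y\<in>S. y \<noteq> x \<longrightarrow> ereal m < f y"
      by (auto simp: eventually_at_topological)
    have "ereal m < f y" if "y \<in> S" for y
      using S(3) m that by (cases "y = x") auto
    then show "\<exists>T. open T \<and> x \<in> T \<and> T \<subseteq> {y. ereal m < f y}"
      using S(1,2) by (intro exI[of _ S]) auto
  qed
  moreover have "- epigraph f = (\<Union>m. {y. ereal m < f y} \<times> {..<m})"
  proof (intro equalityI subsetI)
    fix p assume "p \<in> - epigraph f"
    then obtain y r where p: "p = (y, r)" "ereal r < f y" by (cases p) (simp add: epigraph_def not_le)
    then obtain m where "ereal r < ereal m" "ereal m < f y" using ereal_dense2[OF p(2)] by blast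
    then have "p \<in> {y. ereal m < f y} \<times> {..<m}" using p(1) by simp
    then show "p \<in> (\<Union>m. {y. ereal m < f y} \<times> {..<m})" by blast
  next
    fix p assume "p \<in> (\<Union>m. {y. ereal m < f y} \<times> {..<m})"
    then obtain y r m where p: "p = (y, r)" "ereal m < f y" "r < m" by (cases p) blast
    have "ereal r < ereal m" using p(3) by simp
    also note p(2)
    finally show "p \<in> - epigraph f" by (simp add: p(1) epigraph_def not_le)
  qed
  ultimately show ?thesis by (simp add: closed_def open_Times open_UN)
qed

lemma epigraph_separation:
  fixes f :: "'a::euclidean_space \<Rightarrow> ereal"
  assumes "proper_fun f" "lsc_fun f" "convex_fun f" "ereal M < f x"
  obtains v s b where "v \<bullet> x + s * M < b" "0 \<le> s" "\<And>y r. f y \<le> ereal r \<Longrightarrow> b < v \<bullet> y + s * r"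
proof -
  have "(x, M) \<notin> epigraph f" using assms(4) by (auto simp: epigraph_def)
  then obtain a b where a: "a \<bullet> (x, M) < b" "\<And>p. p \<in> epigraph f \<Longrightarrow> b < a \<bullet> p"
    using separating_hyperplane_closed_point[OF convex_epigraph closed_epigraph] assms by blast
  obtain v s where vs: "a = (v, s)" by fastforce
  have *: "b < v \<bullet> y + s * r" if "f y \<le> ereal r" for y r
    using a(2)[of "(y, r)"] that by (auto simp: epigraph_def vs)
  have "0 \<le> s"
  proof (rule ccontr)
    \<comment> \<open>A negative \<open>s\<close> is refuted by going up the epigraph above a point of the domain.\<close>
    assume "\<not> 0 \<le> s"
    obtain y where "f y < \<infinity>" using assms(1) by (auto simp: proper_fun_def eff_dom_def)
    then obtain r where r: "f y \<le> ereal r" by (cases "f y") auto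
    define k where "k = \<bar>v \<bullet> y + s * r - b\<bar> / (- s)"
    have "0 \<le> k" using \<open>\<not> 0 \<le> s\<close> unfolding k_def by (intro divide_nonneg_nonneg) auto
    then have "f y \<le> ereal (r + k)" using r by (meson add_increasing2 ereal_less_eq(3) order_refl order_trans)
    from *[OF this] have "b < v \<bullet> y + s * r + s * k" by (simp add: algebra_simps)
    also have "s * k = - \<bar>v \<bullet> y + s * r - b\<bar>" using \<open>\<not> 0 \<le> s\<close> by (simp add: k_def)
    finally show False by linarith
  qed
  then show ?thesis using that[of v s b] a(1) * by (simp add: vs)
qed

lemma affine_minorant_of_nonvertical:
  fixes f :: "'a::euclidean_space \<Rightarrow> ereal"
  assumes "v \<bullet> x + s * M < b" "0 < s" "\<And>y r. f y \<le> ereal r \<Longrightarrow> b < v \<bullet> y + s * r"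
  obtains u c where "\<And>y. ereal (u \<bullet> y - c) \<le> f y" "M < u \<bullet> x - c"
proof
  fix y
  show "ereal ((- (1 / s) *\<^sub>R v) \<bullet> y - (- b / s)) \<le> f y"
  proof (rule ereal_le_real)
    fix r assume "f y \<le> ereal r"
    then show "ereal ((- (1 / s) *\<^sub>R v) \<bullet> y - (- b / s)) \<le> ereal r"
      using assms(3)[of y r] assms(2) by (simp add: field_simps)
  qed
next
  show "M < (- (1 / s) *\<^sub>R v) \<bullet> x - (- b / s)" using assms(1,2) by (simp add: field_simps)
qed

text \<open>
  Below a point \<open>x\<close> of the domain the separating hyperplane cannot be vertical, because it
  separates \<open>(x, r - 1)\<close> from the point \<open>(x, r)\<close> of the epigraph directly above it.
\<close>

lemma affine_minorant_exists:
  fixes f :: "'a::euclidean_space \<Rightarrow> ereal"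
  assumes "proper_fun f" "lsc_fun f" "convex_fun f"
  obtains u c where "\<And>y. ereal (u \<bullet> y - c) \<le> f y"
proof -
  obtain x where x: "f x < \<infinity>" "f x \<noteq> -\<infinity>"
    using assms(1) by (auto simp: proper_fun_def eff_dom_def)
  then obtain r where r: "f x = ereal r" by (cases "f x") auto
  then have "ereal (r - 1) < f x" by simp
  then obtain v s b where *: "v \<bullet> x + s * (r - 1) < b" "0 \<le> s"
      "\<And>y r. f y \<le> ereal r \<Longrightarrow> b < v \<bullet> y + s * r"
    using epigraph_separation[OF assms] by metis
  have "b < v \<bullet> x + s * r" using *(3) r by simp
  then have "0 < s" using *(1,2) by (cases "s = 0") auto
  show ?thesis
    by (rule affine_minorant_of_nonvertical[OF *(1) \<open>0 < s\<close> *(3)]) (auto intro: that)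
qed

lemma eff_dom_conjugate_nonempty:
  fixes f :: "'a::euclidean_space \<Rightarrow> ereal"
  assumes "proper_fun f" "lsc_fun f" "convex_fun f"
  shows "eff_dom (conjugate f) \<noteq> {}"
proof -
  obtain u c where "\<And>y. ereal (u \<bullet> y - c) \<le> f y" using affine_minorant_exists[OF assms] by blast
  then have "u \<in> eff_dom (conjugate f)" unfolding eff_dom_conjugate_iff by blast
  then show ?thesis by blast
qed

text \<open>
  If the hyperplane separating \<open>(x, M)\<close> from the epigraph is vertical, then \<open>x\<close> is outside the
  domain and the hyperplane is an affine function that is negative on the domain and positive at
  \<open>x\<close>. Adding a large multiple of it to any affine minorant lifts the value at \<open>x\<close> above \<open>M\<close>.
\<close>

lemma affine_minorant_above:
  fixes f :: "'a::euclidean_space \<Rightarrow> ereal"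
  assumes "proper_fun f" "lsc_fun f" "convex_fun f" "ereal M < f x"
  obtains u c where "\<And>y. ereal (u \<bullet> y - c) \<le> f y" "M < u \<bullet> x - c"
proof -
  obtain v s b where *: "v \<bullet> x + s * M < b" "0 \<le> s"
      "\<And>y r. f y \<le> ereal r \<Longrightarrow> b < v \<bullet> y + s * r"
    using epigraph_separation[OF assms] by metis
  show ?thesis
  proof (cases "s = 0")
    case False
    then have "0 < s" using *(2) by simp
    show ?thesis
      by (rule affine_minorant_of_nonvertical[OF *(1) \<open>0 < s\<close> *(3)]) (auto intro: that)
  next
    case True
    obtain u c where uc: "\<And>y. ereal (u \<bullet> y - c) \<le> f y" using affine_minorant_exists[OF assms(1-3)] by blast
    define k where "k = (\<bar>M - (u \<bullet> x - c)\<bar> + 1) / (b - v \<bullet> x)"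
    have pos: "0 < b - v \<bullet> x" using * True by simp
    then have k0: "0 \<le> k" by (simp add: k_def)
    have kx: "k * (b - v \<bullet> x) = \<bar>M - (u \<bullet> x - c)\<bar> + 1" using pos by (simp add: k_def)
    show ?thesis
    proof (rule that)
      fix y
      show "ereal ((u - k *\<^sub>R v) \<bullet> y - (c - k * b)) \<le> f y"
      proof (rule ereal_le_real)
        fix r assume r: "f y \<le> ereal r"
        have "b < v \<bullet> y" using *(3)[OF r] True by simp
        then have "k * b \<le> k * (v \<bullet> y)" using k0 by (simp add: mult_left_mono)
        moreover have "u \<bullet> y - c \<le> r" using order_trans[OF uc r] by simp
        ultimately show "ereal ((u - k *\<^sub>R v) \<bullet> y - (c - k * b)) \<le> ereal r"
          by (simp add: inner_diff_left)
      qed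
    next
      show "M < (u - k *\<^sub>R v) \<bullet> x - (c - k * b)"
        using kx by (simp add: inner_diff_left algebra_simps)
    qed
  qed
qed

section \<open>The recession function as a support function\<close>

text \<open>
  Along \<open>d\<close> no affine minorant rises faster than \<open>s\<close>, and \<open>f\<close> is the supremum of its minorants.
\<close>

lemma upper_bound_by_slopes:
  fixes f :: "'a::euclidean_space \<Rightarrow> ereal"
  assumes f: "proper_fun f" "lsc_fun f" "convex_fun f"
    and x: "f x = ereal r" and s: "\<And>u. u \<in> eff_dom (conjugate f) \<Longrightarrow> u \<bullet> d \<le> s" and t: "0 \<le> t"
  shows "f (x + t *\<^sub>R d) \<le> ereal (r + t * s)"
proof (rule ccontr)
  assume "\<not> ?thesis"
  then have "ereal (r + t * s) < f (x + t *\<^sub>R d)" by (simp only: not_le)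
  then obtain u c where u: "\<And>y. ereal (u \<bullet> y - c) \<le> f y" "r + t * s < u \<bullet> (x + t *\<^sub>R d) - c"
    by (rule affine_minorant_above[OF f]) blast
  have "u \<in> eff_dom (conjugate f)" unfolding eff_dom_conjugate_iff using u(1) by blast
  then have "u \<bullet> d \<le> s" by (rule s)
  then have "t * (u \<bullet> d) \<le> t * s" using t by (rule mult_left_mono)
  moreover have "u \<bullet> x - c \<le> r" using u(1)[of x] x by simp
  ultimately show False using u(2) by (simp add: inner_add_right)
qed

text \<open>
  The upper bound on the difference quotients holds for every positive \<open>t\<close>, and the lower bound
  given by a minorant of slope \<open>u\<close> tends to \<open>u \<bullet> d\<close>. The two bounds squeeze the quotients from
  every base point to the same value, so that the limit exists and is unique.
\<close>

lemma recession_eq_support_fun: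
  fixes f :: "'a::euclidean_space \<Rightarrow> ereal"
  assumes f: "proper_fun f" "lsc_fun f" "convex_fun f"
  shows "recession f d = support_fun (eff_dom (conjugate f)) d"
proof -
  let ?C = "eff_dom (conjugate f)" and ?Q = "\<lambda>x t::real. (f (x + t *\<^sub>R d) - f x) / ereal t"
  obtain u0 where u0: "u0 \<in> ?C" using eff_dom_conjugate_nonempty[OF f] by blast
  have lim: "(?Q x \<longlongrightarrow> support_fun ?C d) at_top" if "x \<in> eff_dom f" for x
  proof -
    have "f x \<noteq> \<infinity>" "f x \<noteq> -\<infinity>" using that f(1) by (auto simp: eff_dom_def proper_fun_def)
    then obtain r where r: "f x = ereal r" by (cases "f x") auto
    have up: "?Q x t \<le> support_fun ?C d" if t: "0 < t" for t
    proof (cases "support_fun ?C d")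
      case (real s)
      have "u \<bullet> d \<le> s" if "u \<in> ?C" for u
        using SUP_upper[OF that, of "\<lambda>u. ereal (u \<bullet> d)"] real by (simp add: support_fun_def)
      then have "f (x + t *\<^sub>R d) \<le> ereal (r + t * s)"
        using upper_bound_by_slopes[OF f r] t by simp
      then show ?thesis using t r real f(1)
        by (cases "f (x + t *\<^sub>R d)") (auto simp: proper_fun_def field_simps)
    next
      case MInf
      then show ?thesis using SUP_upper[OF u0, of "\<lambda>u. ereal (u \<bullet> d)"] by (simp add: support_fun_def)
    qed simp
    show ?thesis
    proof (rule order_tendstoI)
      fix a assume "a < support_fun ?C d"
      then obtain u where u: "u \<in> ?C" "a < ereal (u \<bullet> d)"
        by (auto simp: support_fun_def less_SUP_iff)
      obtain c where c: "\<And>y. ereal (u \<bullet> y - c) \<le> f y"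
        using u(1) unfolding eff_dom_conjugate_iff by blast
      have "((\<lambda>t. (u \<bullet> x - c - r) * inverse t + u \<bullet> d) \<longlongrightarrow> (u \<bullet> x - c - r) * 0 + u \<bullet> d) at_top"
        by (intro tendsto_intros tendsto_inverse_0_at_top filterlim_ident)
      then have "((\<lambda>t. ereal ((u \<bullet> x - c - r) * inverse t + u \<bullet> d)) \<longlongrightarrow> ereal (u \<bullet> d)) at_top"
        by simp
      then have "eventually (\<lambda>t. a < ereal ((u \<bullet> x - c - r) * inverse t + u \<bullet> d)) at_top"
        using u(2) by (rule order_tendstoD)
      then show "eventually (\<lambda>t. a < ?Q x t) at_top"
        using eventually_gt_at_top[of 0]
      proof eventually_elim
        case (elim t)
        have "(u \<bullet> x - c - r) * inverse t + u \<bullet> d = (u \<bullet> (x + t *\<^sub>R d) - c - r) / t"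
          using elim(2) by (simp add: inner_add_right field_simps)
        then have "ereal ((u \<bullet> x - c - r) * inverse t + u \<bullet> d) \<le> ?Q x t"
          using c[of "x + t *\<^sub>R d"] elim(2) r
          by (cases "f (x + t *\<^sub>R d)") (auto intro: divide_right_mono)
        then show ?case using elim(1) by simp
      qed
    next
      fix a assume a: "support_fun ?C d < a"
      show "eventually (\<lambda>t. ?Q x t < a) at_top"
        using eventually_gt_at_top[of 0] by eventually_elim (use up a in \<open>auto intro: le_less_trans\<close>)
    qed
  qed
  obtain x where x: "x \<in> eff_dom f" using f(1) by (auto simp: proper_fun_def)
  show ?thesis unfolding recession_def
  proof (rule the_equality)
    show "\<forall>x\<in>eff_dom f. (?Q x \<longlongrightarrow> support_fun ?C d) at_top" using lim by blast
  next
    fix l assume "\<forall>x\<in>eff_dom f. (?Q x \<longlongrightarrow> l) at_top"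
    then show "l = support_fun ?C d" using lim x tendsto_unique trivial_limit_at_top_linorder by blast
  qed
qed

text \<open>
  On \<open>D\<close> a vector and its projection onto \<open>D\<close> have the same inner products.
\<close>

lemma support_fun_orth_proj:
  assumes "subspace D" "d \<in> D"
  shows "support_fun (orth_proj D ` C) d = support_fun C d"
  by (simp add: support_fun_def image_image orth_proj_inner[OF assms])

section \<open>Linear growth of coercive convex functions\<close>

text \<open>
  If the function exceeds \<open>f x0 + 1\<close> at distance at least \<open>R\<close> from \<open>x0\<close> along \<open>D\<close>, then the
  point at distance \<open>R\<close> in direction \<open>d\<close> lies on the segment from \<open>x0\<close> to \<open>x0 + d\<close>, and
  convexity gives \<open>f (x0 + d) \<ge> f x0 + norm d / R\<close>. At distance less than \<open>R\<close> an affine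
  minorant provides a lower bound.
\<close>

lemma coercive_linear_growth:
  fixes f :: "'a::euclidean_space \<Rightarrow> ereal"
  assumes f: "proper_fun f" "lsc_fun f" "convex_fun f"
    and D: "subspace D" and coe: "coercive_wrt f D" and x0: "x0 \<in> eff_dom f"
  obtains \<alpha> c where "0 < \<alpha>" "\<And>d. d \<in> D \<Longrightarrow> ereal (\<alpha> * norm d - c) \<le> f (x0 + d)"
proof -
  obtain r where r: "f x0 = ereal r"
    using x0 f(1) by (cases "f x0") (auto simp: eff_dom_def proper_fun_def)
  have "eventually (\<lambda>x. ereal (r + 1) < f x) (filtercomap (\<lambda>x. norm (orth_proj D x)) at_top)"
    using coe by (simp add: coercive_wrt_def tendsto_PInfty)
  then obtain N where N: "\<And>x. norm (orth_proj D x) \<ge> N \<Longrightarrow> ereal (r + 1) < f x"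
    by (auto simp: eventually_filtercomap_at_top_linorder)
  \<comment> \<open>Coercivity measures \<open>x0 + d\<close>, whose projection is shifted from \<open>d\<close> by at most \<open>norm x0\<close>.\<close>
  define R where "R = max 1 (N + norm x0)"
  have R: "0 < R" by (simp add: R_def)
  have far: "ereal (r + 1) < f (x0 + d)" if "d \<in> D" "R \<le> norm d" for d
  proof (rule N)
    have "norm d \<le> norm (orth_proj D x0 + d) + norm (orth_proj D x0)"
      using norm_triangle_ineq4[of "orth_proj D x0 + d" "orth_proj D x0"] by simp
    moreover have "orth_proj D (x0 + d) = orth_proj D x0 + d"
      using linear_add[OF linear_orth_proj[OF D]] orth_proj_id[OF D that(1)] by simp
    ultimately show "N \<le> norm (orth_proj D (x0 + d))"
      using that(2) norm_orth_proj_le[OF D, of x0] by (simp add: R_def)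
  qed
  obtain u b where ub: "\<And>y. ereal (u \<bullet> y - b) \<le> f y" using affine_minorant_exists[OF f] by blast
  define c where "c = max (- r) (norm u * R + 1 - u \<bullet> x0 + b)"
  show ?thesis
  proof (rule that[of "1 / R" c])
    show "0 < 1 / R" using R by simp
  next
    fix d assume d: "d \<in> D"
    show "ereal (1 / R * norm d - c) \<le> f (x0 + d)"
    proof (cases "R \<le> norm d")
      case True
      define t where "t = R / norm d"
      have nd: "0 < norm d" using True R by linarith
      have t: "0 < t" "t \<le> 1" using True R nd by (auto simp: t_def)
      show ?thesis
      proof (rule ereal_le_real)
        fix q assume q: "f (x0 + d) \<le> ereal q"
        have "ereal (r + 1) < f (x0 + t *\<^sub>R d)"
          using nd R by (intro far) (auto simp: t_def subspace_scale D d)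
        also have "x0 + t *\<^sub>R d = (1 - t) *\<^sub>R x0 + t *\<^sub>R (x0 + d)" by (simp add: algebra_simps)
        also have "f \<dots> \<le> ereal (1 - t) * f x0 + ereal t * f (x0 + d)"
          using f(3) t unfolding convex_fun_def by simp
        also have "\<dots> \<le> ereal (1 - t) * ereal r + ereal t * ereal q"
          using t q r by (intro add_mono ereal_mult_left_mono) auto
        finally have "r + 1 < (1 - t) * r + t * q" by simp
        then have "1 / t < q - r" using t by (simp add: field_simps)
        then have "1 / R * norm d < q - r" using nd by (simp add: t_def)
        then show "ereal (1 / R * norm d - c) \<le> ereal q" by (simp add: c_def)
      qed
    next
      case False
      then have "1 / R * norm d \<le> 1" using R by (simp add: field_simps)
      moreover have "- (u \<bullet> d) \<le> norm u * R"
      proof -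
        have "- (u \<bullet> d) \<le> norm u * norm d" using Cauchy_Schwarz_ineq2[of u d] by linarith
        also have "\<dots> \<le> norm u * R" using False by (intro mult_left_mono) auto
        finally show ?thesis .
      qed
      ultimately have "1 / R * norm d - c \<le> u \<bullet> (x0 + d) - b"
        by (simp add: c_def inner_add_right)
      then show ?thesis using ub[of "x0 + d"] by (meson ereal_less_eq(3) order_trans)
    qed
  qed
qed

text \<open>
  The component of \<open>u\<close> orthogonal to \<open>D\<close> does not affect the values of \<open>u \<bullet> d\<close> on \<open>D\<close>, so only
  the size of the projection matters.
\<close>

lemma small_projection_in_dom_conjugate:
  fixes f :: "'a::euclidean_space \<Rightarrow> ereal"
  assumes growth: "\<And>d. d \<in> D \<Longrightarrow> ereal (\<alpha> * norm d - c) \<le> f (x0 + d)"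
    and D: "subspace D" and u: "norm (orth_proj D u) \<le> \<alpha>"
  shows "u \<in> eff_dom (conjugate (restr (\<lambda>d. f (x0 + d)) D))"
proof -
  have "ereal (u \<bullet> d - c) \<le> restr (\<lambda>d. f (x0 + d)) D d" for d
  proof (cases "d \<in> D")
    case True
    have "u \<bullet> d = orth_proj D u \<bullet> d" using orth_proj_inner[OF D True] by simp
    also have "\<dots> \<le> norm (orth_proj D u) * norm d" by (rule norm_cauchy_schwarz)
    also have "\<dots> \<le> \<alpha> * norm d" using u by (rule mult_right_mono) simp
    finally have "ereal (u \<bullet> d - c) \<le> ereal (\<alpha> * norm d - c)" by simp
    also have "\<dots> \<le> f (x0 + d)" by (rule growth[OF True])
    finally show ?thesis using True by (simp add: restr_def)
  qed (simp add: restr_def)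
  then show ?thesis unfolding eff_dom_conjugate_iff by blast
qed

section \<open>The origin in the relative interior\<close>

text \<open>
  Outside the closure a strict separation is available; on the relative boundary a supporting
  hyperplane is strict on the relative interior. Either way the normal \<open>a\<close> satisfies
  \<open>0 \<le> a \<bullet> v\<close> on \<open>C\<close> with strict inequality somewhere, and since \<open>C\<close> lies in \<open>D\<close>, the direction
  \<open>- a\<close>, projected onto \<open>D\<close>, is nonzero and has no positive inner product with \<open>C\<close>.
\<close>

lemma zero_in_rel_interior:
  fixes C :: "'a::euclidean_space set"
  assumes D: "subspace D" and C: "convex C" "C \<noteq> {}" "C \<subseteq> D"
    and pos: "\<And>d. d \<in> D \<Longrightarrow> d \<noteq> 0 \<Longrightarrow> \<exists>v\<in>C. 0 < v \<bullet> d"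
  shows "0 \<in> rel_interior C"
proof (rule ccontr)
  assume nri: "0 \<notin> rel_interior C"
  have "\<exists>a. (\<forall>v\<in>C. 0 \<le> a \<bullet> v) \<and> (\<exists>v\<in>C. 0 < a \<bullet> v)"
  proof (cases "0 \<in> closure C")
    case False
    then obtain a b where "0 < b" "\<forall>v\<in>closure C. b < a \<bullet> v"
      using separating_hyperplane_closed_0[of "closure C"] C(1) by (auto simp: convex_closure)
    then have "\<forall>v\<in>C. 0 < a \<bullet> v" using closure_subset by (meson less_trans subsetD)
    then show ?thesis using C(2) by (metis all_not_in_conv less_imp_le)
  next
    case True
    obtain a where "\<And>v. v \<in> closure C \<Longrightarrow> a \<bullet> 0 \<le> a \<bullet> v"
        "\<And>v. v \<in> rel_interior C \<Longrightarrow> a \<bullet> 0 < a \<bullet> v"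
      using supporting_hyperplane_relative_frontier[OF C(1) True nri] by metis
    moreover obtain w where "w \<in> rel_interior C" using rel_interior_eq_empty[OF C(1)] C(2) by blast
    ultimately show ?thesis using closure_subset rel_interior_subset by (metis inner_zero_right subsetD)
  qed
  then obtain a w where a: "\<And>v. v \<in> C \<Longrightarrow> 0 \<le> a \<bullet> v" and w: "w \<in> C" "0 < a \<bullet> w" by blast
  let ?d = "- orth_proj D a"
  have inner: "v \<bullet> ?d = - (a \<bullet> v)" if "v \<in> C" for v
    using orth_proj_inner[OF D, of v a] that C(3) by (auto simp: inner_commute)
  have "?d \<in> D" using D by (simp add: subspace_neg orth_proj_props)
  moreover have "?d \<noteq> 0" using inner[OF w(1)] w(2) by auto
  ultimately obtain v where "v \<in> C" "0 < v \<bullet> ?d" using pos by blast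
  then show False using inner a by force
qed

lemma zero_in_rel_interior_proj_dom_conjugate:
  fixes f :: "'a::euclidean_space \<Rightarrow> ereal"
  assumes f: "proper_fun f" "lsc_fun f" "convex_fun f"
    and D: "subspace D" and coe: "coercive_wrt f D"
  shows "0 \<in> rel_interior (orth_proj D ` eff_dom (conjugate f))"
proof (rule zero_in_rel_interior[OF D])
  let ?C = "eff_dom (conjugate f)"
  show "convex (orth_proj D ` ?C)"
    by (intro convex_linear_image linear_orth_proj D convex_eff_dom_conjugate)
  show "orth_proj D ` ?C \<noteq> {}"
    using eff_dom_conjugate_nonempty[OF f] by simp
  show "orth_proj D ` ?C \<subseteq> D" using orth_proj_props(1)[OF D] by blast
  fix d assume d: "d \<in> D" "d \<noteq> 0"
  show "\<exists>v\<in>orth_proj D ` ?C. 0 < v \<bullet> d"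
  proof (rule ccontr)
    assume "\<not> ?thesis"
    then have le: "u \<bullet> d \<le> 0" if "u \<in> ?C" for u
      using that orth_proj_inner[OF D d(1), of u] by force
    obtain x where x: "x \<in> eff_dom f" using f(1) by (auto simp: proper_fun_def)
    then obtain r where r: "f x = ereal r"
      using f(1) by (cases "f x") (auto simp: eff_dom_def proper_fun_def)
    obtain \<alpha> c where g: "0 < \<alpha>" "\<And>d. d \<in> D \<Longrightarrow> ereal (\<alpha> * norm d - c) \<le> f (x + d)"
      using coercive_linear_growth[OF f D coe x] by blast
    \<comment> \<open>At this \<open>t\<close> the linear lower bound exceeds the constant upper bound \<open>r\<close> by at least \<open>1\<close>.\<close>
    define t where "t = (\<bar>r + c\<bar> + 1) / (\<alpha> * norm d)"
    have t0: "0 \<le> t" using g(1) by (simp add: t_def)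
    have "f (x + t *\<^sub>R d) \<le> ereal (r + t * 0)"
      by (rule upper_bound_by_slopes[OF f r le t0])
    moreover have "ereal (\<alpha> * norm (t *\<^sub>R d) - c) \<le> f (x + t *\<^sub>R d)"
      by (intro g(2) subspace_scale D d(1))
    ultimately have "\<alpha> * norm (t *\<^sub>R d) - c \<le> r"
      by (metis add.right_neutral ereal_less_eq(3) mult_zero_right order_trans)
    moreover have "\<alpha> * norm (t *\<^sub>R d) = \<bar>r + c\<bar> + 1"
      using t0 g(1) d(2) by (simp add: t_def)
    ultimately show False by linarith
  qed
qed

section \<open>The kernel of a matrix\<close>

lemma subspace_ker_mat: "subspace (ker_mat A)"
  by (simp add: subspace_def ker_mat_def matrix_vector_right_distrib scaleR_matrix_vector_assoc[symmetric]
      matrix_vector_mult_scaleR)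

lemma ran_transpose_eq_orthogonal_comp_ker:
  "ran_mat (transpose A) = (ker_mat A)\<^sup>\<bottom>"
proof -
  have "ker_mat A = (\<lambda>x. A *v x) -` {0}" by (auto simp: ker_mat_def)
  also have "\<dots> = (ran_mat (transpose A))\<^sup>\<bottom>"
    by (simp add: ker_orthogonal_comp_adjoint adjoint_matrix ran_mat_def)
  finally have "(ker_mat A)\<^sup>\<bottom> = (ran_mat (transpose A))\<^sup>\<bottom>\<^sup>\<bottom>" by simp
  moreover have "subspace (ran_mat (transpose A))"
    unfolding ran_mat_def by (rule linear_subspace_image[OF matrix_vector_mul_linear subspace_UNIV])
  ultimately show ?thesis by (simp add: orthogonal_comp_self)
qed

lemma ran_transpose_plus_ball:
  assumes "0 \<le> \<alpha>"
  shows "ran_mat (transpose A) + (cball 0 \<alpha> \<inter> ker_mat A)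
    = {u. norm (orth_proj (ker_mat A) u) \<le> \<alpha>}"
proof (intro equalityI subsetI)
  let ?D = "ker_mat A"
  note D = subspace_ker_mat[of A]
  fix u assume "u \<in> ran_mat (transpose A) + (cball 0 \<alpha> \<inter> ?D)"
  then obtain v w where u: "u = v + w" "v \<in> ?D\<^sup>\<bottom>" "w \<in> ?D" "norm w \<le> \<alpha>"
    by (auto simp: set_plus_def ran_transpose_eq_orthogonal_comp_ker)
  have "orth_proj ?D u = w"
    by (rule orth_proj_unique[OF D]) (use u in \<open>auto simp: orthogonal_comp_def orthogonal_commute\<close>)
  then show "u \<in> {u. norm (orth_proj ?D u) \<le> \<alpha>}" using u by simp
next
  let ?D = "ker_mat A"
  note D = subspace_ker_mat[of A]
  fix u assume u: "u \<in> {u. norm (orth_proj ?D u) \<le> \<alpha>}"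
  have "u - orth_proj ?D u \<in> ran_mat (transpose A)"
    unfolding ran_transpose_eq_orthogonal_comp_ker
    using orth_proj_props(2)[OF D] by (auto simp: orthogonal_comp_def orthogonal_def inner_commute)
  moreover have "orth_proj ?D u \<in> cball 0 \<alpha> \<inter> ?D" using u orth_proj_props(1)[OF D] by simp
  ultimately have "(u - orth_proj ?D u) + orth_proj ?D u \<in> ran_mat (transpose A) + (cball 0 \<alpha> \<inter> ?D)"
    by (rule set_plus_intro)
  then show "u \<in> ran_mat (transpose A) + (cball 0 \<alpha> \<inter> ?D)" by simp
qed

section \<open>Consequences of coercivity on the kernel\<close>

theorem theorem2p14:
  fixes f :: "real^'n \<Rightarrow> ereal" and A :: "real^'n^'m"
  assumes "proper_fun f" and "lsc_fun f" and "convex_fun f"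
    and "coercive_wrt f (ker_mat A)"
  shows
    "(\<forall>x0\<in>eff_dom f. \<exists>\<alpha>>0.
        cball 0 \<alpha> \<subseteq> ran_mat (transpose A) + (cball 0 \<alpha> \<inter> ker_mat A) \<and>
        ran_mat (transpose A) + (cball 0 \<alpha> \<inter> ker_mat A)
          \<subseteq> eff_dom (conjugate (restr (\<lambda>d. f (x0 + d)) (ker_mat A))))
     \<and>
     (\<forall>x0\<in>eff_dom f.
        0 \<in> interior (eff_dom (conjugate (restr (\<lambda>d. f (x0 + d)) (ker_mat A)))))
     \<and>
     (0 \<in> eff_dom f \<longrightarrow>
        (\<exists>\<alpha>>0. cball 0 \<alpha> \<subseteq> eff_dom (conjugate (restr f (ker_mat A)))) \<and>
        0 \<in> interior (eff_dom (conjugate (restr f (ker_mat A)))))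
     \<and>
     (restr (recession f) (ker_mat A)
        = restr (support_fun (orth_proj (ker_mat A) ` eff_dom (conjugate f))) (ker_mat A) \<and>
      restr (support_fun (orth_proj (ker_mat A) ` eff_dom (conjugate f))) (ker_mat A)
        = restr (support_fun (eff_dom (conjugate f))) (ker_mat A))
     \<and>
     0 \<in> rel_interior (orth_proj (ker_mat A) ` eff_dom (conjugate f))"
proof -
  let ?D = "ker_mat A"
  note f = assms(1-3) and D = subspace_ker_mat[of A]
  have slices: "\<exists>\<alpha>>0. cball 0 \<alpha> \<subseteq> ran_mat (transpose A) + (cball 0 \<alpha> \<inter> ?D) \<and>
      ran_mat (transpose A) + (cball 0 \<alpha> \<inter> ?D)
        \<subseteq> eff_dom (conjugate (restr (\<lambda>d. f (x0 + d)) ?D))" if x0: "x0 \<in> eff_dom f" for x0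
  proof -
    obtain \<alpha> c where g: "0 < \<alpha>" "\<And>d. d \<in> ?D \<Longrightarrow> ereal (\<alpha> * norm d - c) \<le> f (x0 + d)"
      using coercive_linear_growth[OF f D assms(4) x0] by blast
    have "cball 0 \<alpha> \<subseteq> {u. norm (orth_proj ?D u) \<le> \<alpha>}"
      using order_trans[OF norm_orth_proj_le[OF D]] by auto
    moreover have "{u. norm (orth_proj ?D u) \<le> \<alpha>}
        \<subseteq> eff_dom (conjugate (restr (\<lambda>d. f (x0 + d)) ?D))"
      using small_projection_in_dom_conjugate[OF g(2) D] by blast
    ultimately show ?thesis
      using g(1) ran_transpose_plus_ball[of \<alpha> A] by (intro exI[of _ \<alpha>]) simp
  qed
  have ball: "\<exists>\<alpha>>0. cball 0 \<alpha> \<subseteq> eff_dom (conjugate (restr (\<lambda>d. f (x0 + d)) ?D))"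
    if "x0 \<in> eff_dom f" for x0
    using slices[OF that] by blast
  have int: "0 \<in> interior (eff_dom (conjugate (restr (\<lambda>d. f (x0 + d)) ?D)))"
    if "x0 \<in> eff_dom f" for x0
    using ball[OF that] by (simp add: mem_interior_cball)
  have "restr (recession f) ?D = restr (support_fun (eff_dom (conjugate f))) ?D"
    by (simp add: restr_def recession_eq_support_fun[OF f] fun_eq_iff)
  moreover have "restr (support_fun (orth_proj ?D ` eff_dom (conjugate f))) ?D
      = restr (support_fun (eff_dom (conjugate f))) ?D"
    by (simp add: restr_def support_fun_orth_proj[OF D] fun_eq_iff)
  moreover have "0 \<in> rel_interior (orth_proj ?D ` eff_dom (conjugate f))"
    by (rule zero_in_rel_interior_proj_dom_conjugate[OF f D assms(4)])
  ultimately show ?thesis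
    using slices int ball[of 0] int[of 0] by simp
qed

end
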